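(* Let $G$ and $G'$ each be both a groupoid and a topological space (no compatibility assumed) with Hausdorff unit spaces $G^0$ and $G'^0$, and let $Y$ and $Y'$ be unital $1$-cancellative semigroups. Assume $S\subseteq{}_Y\mathcal{B}^\circ(G)$ and $S'\subseteq{}_{Y'}\mathcal{B}^\circ(G')$ are bumpy semigroups. If $\phi:S\to S'$ is a diagonal-preserving semigroup isomorphism, then the map $\widetilde{\phi}:G\to G'$ defined by $$\{\widetilde{\phi}(g)\}=\bigcap_{a\in S_g}\mathrm{dom}(\phi(a)),\qquad\text{where } S_g=\{a\in S:g\in\mathrm{int}([Y^\times]a)\},$$ is (well-defined and) an étale groupoid isomorphism, i.e. a homeomorphism and a groupoid isomorphism.
   Context: For a groupoid $G$: $\mathsf{s}(g)=g^{-1}g$, $\mathsf{r}(g)=gg^{-1}$; $G^0$ is the set of units; $gh$ is defined iff $\mathsf{s}(g)=\mathsf{r}(h)$; for $X,X'\subseteq G$, $XX'=\{xx':x\in X,x'\in X',\mathsf{s}(x)=\mathsf{r}(x')\}$ and $X^{-1}=\{x^{-1}:x\in X\}$. A bisection is $B\subseteq G$ with $BB^{-1}\cup B^{-1}B\subseteq G^0$. $\mathcal{O}(G)$ is the topology of $G$, and $\mathcal{B}^\circ(G)$ is the set of open bisections. $\mathrm{int}$ denotes interior in $G$. A unital semigroup $Y$ is $1$-cancellative if for all $x,y\in Y$: $xy=x\Leftrightarrow y=1\Leftrightarrow yx=x$. $Y^\times$ denotes its invertible elements. For a family $\mathcal{X}$ of subsets of $G$, ${}_Y\mathcal{X}$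 is the set of partial functions $a$ from $G$ to $Y$ with domain $\mathrm{dom}(a)\in\mathcal{X}$. For $W\subseteq Y$, $[W]a=\{g\in\mathrm{dom}(a):a(g)\in W\}$, and $[1]a=[\{1\}]a$. If $\mathrm{dom}(a)$ or $\mathrm{dom}(b)$ is a bisection, $ab$ is the function with domain $\mathrm{dom}(a)\mathrm{dom}(b)$ given by $ab(gh)=a(g)b(h)$ for $g\in\mathrm{dom}(a)$, $h\in\mathrm{dom}(b)$, $\mathsf{s}(g)=\mathsf{r}(h)$; semigroups of functions carry this product. $S\subseteq{}_Y\mathcal{B}^\circ(G)$ is bumpy if: (1-Proper) $[1]a$ is compact for all $a\in S$; (Urysohn) the empty function is in $S$, and whenever $g\in O\in\mathcal{O}(G)$ there is $a\in S$ with $\mathrm{dom}(a)\subseteq O$ and $g\in\mathrm{int}([Y^\times]a)$; (Involutive) whenever $a\in S$ and $g\in\mathrm{int}([Y^\times]a)$, there is $b\in S$ with $g^{-1}\in\mathrm{int}(\{h\in G:a(h^{-1})=b(h)^{-1}\})$. The diagonal of $S$ is $\mathsf{D}(S)=\{d\in S:\mathrm{dom}(d)\subseteq G^0\}$; $\phi:S\to S'$ is diagonal-preserving if $\phi[\mathsf{D}(S)]=\mathsf{D}(S')$. *)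

theory Defs
  imports "HOL-Analysis.T1_Spaces"
begin

text \<open>
  A groupoid has a carrier \<open>arrows\<close>, which may be empty. The operations are total HOL functions;
  the value of \<open>gmult G g h\<close> is only meaningful when \<open>composable G g h\<close> holds.
\<close>

record 'g groupoid_data =
  arrows :: "'g set"
  gmult :: "'g \<Rightarrow> 'g \<Rightarrow> 'g"
  ginv :: "'g \<Rightarrow> 'g"

definition src :: "'g groupoid_data \<Rightarrow> 'g \<Rightarrow> 'g" where
  "src G g = gmult G (ginv G g) g"

definition rng :: "'g groupoid_data \<Rightarrow> 'g \<Rightarrow> 'g" where
  "rng G g = gmult G g (ginv G g)"

definition composable :: "'g groupoid_data \<Rightarrow> 'g \<Rightarrow> 'g \<Rightarrow> bool" where
  "composable G g h \<longleftrightarrow> g \<in> arrows G \<and> h \<in> arrows G \<and> src G g = rng G h"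

text \<open>
  These are the usual axioms (Hahn, Renault) for a partial product with an involution. The remaining
  axiom, that \<open>g\<close> and its inverse are composable in both orders, follows from \<open>inv_inv\<close>.
\<close>

locale groupoid =
  fixes G :: "'g groupoid_data"
  assumes inv_closed: "g \<in> arrows G \<Longrightarrow> ginv G g \<in> arrows G"
    and mult_closed: "composable G g h \<Longrightarrow> gmult G g h \<in> arrows G"
    and inv_inv: "g \<in> arrows G \<Longrightarrow> ginv G (ginv G g) = g"
    and composable_mult_left:
      "composable G g h \<Longrightarrow> composable G h k \<Longrightarrow> composable G (gmult G g h) k"
    and composable_mult_right:
      "composable G g h \<Longrightarrow> composable G h k \<Longrightarrow> composable G g (gmult G h k)"
    and assoc: "composable G g h \<Longrightarrow> composable G h k \<Longrightarrow>
        gmult G (gmult G g h) k = gmult G g (gmult G h k)"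
    and inv_cancel_left: "composable G g h \<Longrightarrow> gmult G (ginv G g) (gmult G g h) = h"
    and inv_cancel_right: "composable G g h \<Longrightarrow> gmult G (gmult G g h) (ginv G h) = g"

definition gunits :: "'g groupoid_data \<Rightarrow> 'g set" where
  "gunits G = src G ` arrows G"

definition set_mult :: "'g groupoid_data \<Rightarrow> 'g set \<Rightarrow> 'g set \<Rightarrow> 'g set" where
  "set_mult G A B = {gmult G g h | g h. g \<in> A \<and> h \<in> B \<and> composable G g h}"

definition bisection :: "'g groupoid_data \<Rightarrow> 'g set \<Rightarrow> bool" where
  "bisection G B \<longleftrightarrow> B \<subseteq> arrows G \<and>
     set_mult G B (ginv G ` B) \<union> set_mult G (ginv G ` B) B \<subseteq> gunits G"

definition open_bisections :: "'g groupoid_data \<Rightarrow> 'g topology \<Rightarrow> 'g set set" where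
  "open_bisections G T = {B. openin T B \<and> bisection G B}"

definition groupoid_iso :: "'g groupoid_data \<Rightarrow> 'h groupoid_data \<Rightarrow> ('g \<Rightarrow> 'h) \<Rightarrow> bool" where
  "groupoid_iso G H f \<longleftrightarrow> bij_betw f (arrows G) (arrows H) \<and>
     (\<forall>g\<in>arrows G. \<forall>h\<in>arrows G.
        (composable G g h \<longleftrightarrow> composable H (f g) (f h)) \<and>
        (composable G g h \<longrightarrow> f (gmult G g h) = gmult H (f g) (f h)))"

definition one_cancellative :: "'y::monoid_mult itself \<Rightarrow> bool" where
  "one_cancellative _ \<longleftrightarrow> (\<forall>x y::'y. (x * y = x \<longleftrightarrow> y = 1) \<and> (y = 1 \<longleftrightarrow> y * x = x))"

definition invertibles :: "'y::monoid_mult set" where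
  "invertibles = {y. \<exists>z. y * z = 1 \<and> z * y = 1}"

definition funs_on :: "'g set set \<Rightarrow> ('g \<rightharpoonup> 'y) set" where
  "funs_on \<X> = {a. dom a \<in> \<X>}"

definition values_in :: "'y set \<Rightarrow> ('g \<rightharpoonup> 'y) \<Rightarrow> 'g set" where
  "values_in W a = {g \<in> dom a. the (a g) \<in> W}"

text \<open>
  The value below is uniquely determined as soon as \<open>dom a\<close> or \<open>dom b\<close> is a bisection, since then
  every element of \<open>set_mult G (dom a) (dom b)\<close> factorises uniquely.
\<close>

definition fun_mult ::
    "'g groupoid_data \<Rightarrow> ('g \<rightharpoonup> 'y::monoid_mult) \<Rightarrow> ('g \<rightharpoonup> 'y) \<Rightarrow> ('g \<rightharpoonup> 'y)" where
  "fun_mult G a b = (\<lambda>k.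
     if k \<in> set_mult G (dom a) (dom b)
     then Some (THE y. \<exists>g\<in>dom a. \<exists>h\<in>dom b.
                  composable G g h \<and> k = gmult G g h \<and> y = the (a g) * the (b h))
     else None)"

text \<open>Associativity of \<open>fun_mult\<close> on such sets is automatic, so only closure is required.\<close>

definition fun_semigroup ::
    "'g groupoid_data \<Rightarrow> 'g topology \<Rightarrow> ('g \<rightharpoonup> 'y::monoid_mult) set \<Rightarrow> bool" where
  "fun_semigroup G T S \<longleftrightarrow> S \<subseteq> funs_on (open_bisections G T) \<and>
     (\<forall>a\<in>S. \<forall>b\<in>S. fun_mult G a b \<in> S)"

definition one_proper :: "'g topology \<Rightarrow> ('g \<rightharpoonup> 'y::monoid_mult) set \<Rightarrow> bool" where
  "one_proper T S \<longleftrightarrow> (\<forall>a\<in>S. compactin T (values_in {1} a))"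

definition urysohn :: "'g topology \<Rightarrow> ('g \<rightharpoonup> 'y::monoid_mult) set \<Rightarrow> bool" where
  "urysohn T S \<longleftrightarrow> Map.empty \<in> S \<and>
     (\<forall>U g. openin T U \<and> g \<in> U \<longrightarrow>
        (\<exists>a\<in>S. dom a \<subseteq> U \<and> g \<in> T interior_of (values_in invertibles a)))"

text \<open>
  The set of \<open>h\<close> with \<open>a(h\<inverse>) = b(h)\<inverse>\<close>: the equation presupposes that both sides exist,
  that is, \<open>h\<inverse> \<in> dom a\<close>, \<open>h \<in> dom b\<close> and \<open>b(h)\<close> is invertible.
\<close>

definition inverse_agree ::
    "'g groupoid_data \<Rightarrow> ('g \<rightharpoonup> 'y::monoid_mult) \<Rightarrow> ('g \<rightharpoonup> 'y) \<Rightarrow> 'g set" where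
  "inverse_agree G a b = {h \<in> arrows G. \<exists>x y. a (ginv G h) = Some x \<and> b h = Some y \<and>
     x * y = 1 \<and> y * x = 1}"

definition involutive ::
    "'g groupoid_data \<Rightarrow> 'g topology \<Rightarrow> ('g \<rightharpoonup> 'y::monoid_mult) set \<Rightarrow> bool" where
  "involutive G T S \<longleftrightarrow>
     (\<forall>a\<in>S. \<forall>g \<in> T interior_of (values_in invertibles a).
        \<exists>b\<in>S. ginv G g \<in> T interior_of (inverse_agree G a b))"

definition bumpy ::
    "'g groupoid_data \<Rightarrow> 'g topology \<Rightarrow> ('g \<rightharpoonup> 'y::monoid_mult) set \<Rightarrow> bool" where
  "bumpy G T S \<longleftrightarrow> S \<subseteq> funs_on (open_bisections G T) \<and>
     one_proper T S \<and> urysohn T S \<and> involutive G T S"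

definition diagonal :: "'g groupoid_data \<Rightarrow> ('g \<rightharpoonup> 'y) set \<Rightarrow> ('g \<rightharpoonup> 'y) set" where
  "diagonal G S = {d \<in> S. dom d \<subseteq> gunits G}"

definition fun_semigroup_iso ::
    "'g groupoid_data \<Rightarrow> ('g \<rightharpoonup> 'y::monoid_mult) set \<Rightarrow>
     'h groupoid_data \<Rightarrow> ('h \<rightharpoonup> 'z::monoid_mult) set \<Rightarrow> (('g \<rightharpoonup> 'y) \<Rightarrow> ('h \<rightharpoonup> 'z)) \<Rightarrow> bool" where
  "fun_semigroup_iso G S H S' \<phi> \<longleftrightarrow> bij_betw \<phi> S S' \<and>
     (\<forall>a\<in>S. \<forall>b\<in>S. \<phi> (fun_mult G a b) = fun_mult H (\<phi> a) (\<phi> b))"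

definition bumps_at :: "'g topology \<Rightarrow> ('g \<rightharpoonup> 'y::monoid_mult) set \<Rightarrow> 'g \<Rightarrow> ('g \<rightharpoonup> 'y) set" where
  "bumps_at T S g = {a \<in> S. g \<in> T interior_of (values_in invertibles a)}"

text \<open>Unspecified unless the intersection is a singleton.\<close>

definition induced_map ::
    "'g topology \<Rightarrow> ('g \<rightharpoonup> 'y::monoid_mult) set \<Rightarrow> (('g \<rightharpoonup> 'y) \<Rightarrow> ('h \<rightharpoonup> 'z)) \<Rightarrow> 'g \<Rightarrow> 'h" where
  "induced_map T S \<phi> g = the_elem (\<Inter>a\<in>bumps_at T S g. dom (\<phi> a))"

end

theory Submission
  imports Defs
begin

text \<open>
  A point \<open>g\<close> of the groupoid is encoded by the set \<open>S\<^sub>g\<close> of all \<open>a \<in> S\<close> that are invertible near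
  \<open>g\<close>, and the idea is to recognise these sets algebraically. Say that \<open>b\<close> dominates \<open>a\<close> if some
  \<open>s \<in> S\<close> satisfies \<open>asb = a = bsa\<close> with \<open>as\<close> and \<open>sa\<close> in the diagonal. Evaluating these equations
  pointwise and cancelling shows that \<open>s(g\<inverse>)\<close> and \<open>b(g)\<close> are mutually inverse for all
  \<open>g \<in> dom a\<close>, and properness then places a compact set between \<open>dom a\<close> and \<open>dom b\<close>
  (\<open>dominated_bump\<close>, \<open>dominated_compact_between\<close>). Conversely the involutive axiom provides local
  inverses, so an element invertible near \<open>g\<close> dominates all elements with small domains around
  \<open>g\<close> (\<open>dominated_near\<close>).

  Hence \<open>S\<^sub>g\<close> is a filter for domination, and as \<open>\<phi>\<close> respects domination, so is
  \<open>\<phi>[S\<^sub>g]\<close>. By compactness the domains of its members share a point \<open>h\<close>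
  (\<open>dominated_filter_has_point\<close>), so \<open>\<phi>[S\<^sub>g] \<subseteq> S'\<^sub>h\<close>. The same argument for
  \<open>\<phi>\<inverse>\<close>, together with the fact that the sets \<open>S\<^sub>g\<close> are pairwise incomparable, gives
  equality (\<open>image_bumps_eq\<close>), so \<open>g \<mapsto> h\<close> is a well-defined bijection whose inverse is induced
  by \<open>\<phi>\<inverse>\<close>. The map is a homeomorphism because the sets
  \<open>{g. a \<in> S\<^sub>g}\<close> form a basis that \<open>\<phi>\<close> carries to the corresponding basis of \<open>G'\<close>.
  It is multiplicative because \<open>S\<^sub>g S\<^sub>h \<subseteq> S\<^sub>g\<^sub>h\<close> and factorisations through
  bisections are unique (\<open>induced_map_mult\<close>).

  Compatibility of the topology with the groupoid operations is a consequence of bumpiness: inversion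
  is continuous by the involutive axiom, products of open sets are open since domains of products are,
  and together these make \<open>src\<close> a local homeomorphism. The groupoid itself may fail to be Hausdorff,
  so compactness arguments take place inside open bisections, which are.
\<close>

section \<open>Groupoids and bisections\<close>

context groupoid
begin

lemma composable_inv_right: "g \<in> arrows G \<Longrightarrow> composable G g (ginv G g)"
  by (simp add: composable_def inv_closed src_def rng_def inv_inv)

lemma composable_inv_left: "g \<in> arrows G \<Longrightarrow> composable G (ginv G g) g"
  by (simp add: composable_def inv_closed src_def rng_def inv_inv)

lemma src_inv: "g \<in> arrows G \<Longrightarrow> src G (ginv G g) = rng G g"
  by (simp add: src_def rng_def inv_inv)

lemma rng_inv: "g \<in> arrows G \<Longrightarrow> rng G (ginv G g) = src G g"
  by (simp add: src_def rng_def inv_inv)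

lemma composable_src: "g \<in> arrows G \<Longrightarrow> composable G g (src G g)"
  unfolding src_def by (intro composable_mult_right composable_inv_right composable_inv_left)

lemma composable_rng: "g \<in> arrows G \<Longrightarrow> composable G (rng G g) g"
  unfolding rng_def by (intro composable_mult_left composable_inv_right composable_inv_left)

lemma mult_src: "g \<in> arrows G \<Longrightarrow> gmult G g (src G g) = g"
  using inv_cancel_left[OF composable_inv_left] by (simp add: inv_inv src_def)

lemma rng_mult: "g \<in> arrows G \<Longrightarrow> gmult G (rng G g) g = g"
  using inv_cancel_right[OF composable_inv_right] by (simp add: inv_inv rng_def)

lemma src_closed: "g \<in> arrows G \<Longrightarrow> src G g \<in> arrows G"
  using composable_src by (simp add: composable_def)

lemma rng_src: "g \<in> arrows G \<Longrightarrow> rng G (src G g) = src G g"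
  using composable_src by (simp add: composable_def)

lemma src_rng: "g \<in> arrows G \<Longrightarrow> src G (rng G g) = rng G g"
  using composable_rng by (simp add: composable_def)

lemma src_product: "composable G g h \<Longrightarrow> src G (gmult G g h) = src G h"
  using composable_mult_left[of g h "src G h"] composable_src[of h] rng_src[of h]
  by (simp add: composable_def)

lemma rng_product: "composable G g h \<Longrightarrow> rng G (gmult G g h) = rng G g"
  using composable_mult_right[of "rng G g" g h] composable_rng[of g] src_rng[of g]
  by (simp add: composable_def)

lemma src_src: "g \<in> arrows G \<Longrightarrow> src G (src G g) = src G g"
  using src_product[OF composable_inv_left] by (simp add: src_def)

lemma src_in_units: "g \<in> arrows G \<Longrightarrow> src G g \<in> gunits G"
  by (simp add: gunits_def)

lemma rng_in_units: "g \<in> arrows G \<Longrightarrow> rng G g \<in> gunits G"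
  using src_in_units[OF inv_closed] by (simp add: src_inv)

lemma src_unit: "u \<in> gunits G \<Longrightarrow> src G u = u"
  by (auto simp: gunits_def src_src)

lemma rng_unit: "u \<in> gunits G \<Longrightarrow> rng G u = u"
  by (auto simp: gunits_def rng_src)

lemma unit_mult:
  assumes "u \<in> gunits G" "composable G u h"
  shows "u = rng G h" "gmult G u h = h"
  using assms src_unit[of u] rng_mult[of h] by (auto simp: composable_def)

lemma mult_unit:
  assumes "u \<in> gunits G" "composable G g u"
  shows "u = src G g" "gmult G g u = g"
  using assms rng_unit[of u] mult_src[of g] by (auto simp: composable_def)

lemma inv_eq_of_mult_unit:
  assumes gh: "composable G g h" and "gmult G g h \<in> gunits G"
  shows "h = ginv G g"
proof -
  have "g \<in> arrows G" using gh by (simp add: composable_def)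
  then have "composable G (ginv G g) (gmult G g h)"
    using gh by (intro composable_mult_right composable_inv_left)
  from mult_unit(2)[OF assms(2) this] show ?thesis
    using inv_cancel_left[OF gh] by simp
qed

lemma bisection_src_inj:
  assumes B: "bisection G B" and gh: "g \<in> B" "h \<in> B" and eq: "src G g = src G h"
  shows "g = h"
proof -
  have arr: "g \<in> arrows G" "h \<in> arrows G" using B gh by (auto simp: bisection_def)
  have c: "composable G g (ginv G h)"
    using arr eq by (simp add: composable_def inv_closed rng_inv)
  then have "gmult G g (ginv G h) \<in> gunits G"
    using B gh unfolding bisection_def set_mult_def by blast
  then have "ginv G h = ginv G g" using c inv_eq_of_mult_unit by blast
  then show ?thesis using arr inv_inv by metis
qed

lemma bisection_rng_inj:
  assumes B: "bisection G B" and gh: "g \<in> B" "h \<in> B" and eq: "rng G g = rng G h"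
  shows "g = h"
proof -
  have arr: "g \<in> arrows G" "h \<in> arrows G" using B gh by (auto simp: bisection_def)
  have c: "composable G (ginv G g) h"
    using arr eq by (simp add: composable_def inv_closed src_inv)
  then have "gmult G (ginv G g) h \<in> gunits G"
    using B gh unfolding bisection_def set_mult_def by blast
  then have "h = ginv G (ginv G g)" using c inv_eq_of_mult_unit by blast
  then show ?thesis using arr inv_inv by simp
qed

lemma bisection_factors_unique:
  assumes "bisection G A" "g \<in> A" "g' \<in> A" "composable G g h" "composable G g' h'"
    "gmult G g h = gmult G g' h'"
  shows "g = g' \<and> h = h'"
proof -
  have "g = g'" using bisection_rng_inj[OF assms(1-3)] assms rng_product by metis
  then show ?thesis using assms inv_cancel_left by metis
qed

text \<open>On the product of a bisection with any set, the definite description in the product of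
  functions denotes: this is the rule by which products of functions are evaluated.\<close>

lemma fun_mult_apply:
  assumes "bisection G (dom a)" "g \<in> dom a" "h \<in> dom b" "composable G g h"
  shows "fun_mult G a b (gmult G g h) = Some (the (a g) * the (b h))"
proof -
  have "gmult G g h \<in> set_mult G (dom a) (dom b)"
    using assms by (auto simp: set_mult_def)
  moreover have "(THE y. \<exists>g'\<in>dom a. \<exists>h'\<in>dom b. composable G g' h' \<and>
      gmult G g h = gmult G g' h' \<and> y = the (a g') * the (b h')) = the (a g) * the (b h)"
  proof (rule the_equality)
    show "\<exists>g'\<in>dom a. \<exists>h'\<in>dom b. composable G g' h' \<and> gmult G g h = gmult G g' h' \<and>
        the (a g) * the (b h) = the (a g') * the (b h')"
      using assms by blast
  next
    fix y assume "\<exists>g'\<in>dom a. \<exists>h'\<in>dom b. composable G g' h' \<and>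
      gmult G g h = gmult G g' h' \<and> y = the (a g') * the (b h')"
    then show "y = the (a g) * the (b h)"
      using bisection_factors_unique[OF assms(1,2)] assms(4) by metis
  qed
  ultimately show ?thesis by (simp add: fun_mult_def)
qed

lemma dom_fun_mult: "dom (fun_mult G a b) = set_mult G (dom a) (dom b)"
  by (auto simp: fun_mult_def split: if_splits)

lemma dom_fun_multE:
  assumes "k \<in> dom (fun_mult G a b)"
  obtains g h where "g \<in> dom a" "h \<in> dom b" "composable G g h" "k = gmult G g h"
  using assms unfolding dom_fun_mult set_mult_def by blast

end

section \<open>The topology determined by a bumpy semigroup\<close>

locale bumpy_semigroup = groupoid G for G :: "'g groupoid_data" +
  fixes T :: "'g topology" and S :: "('g \<rightharpoonup> 'y::monoid_mult) set"
  assumes topspace_arrows: "topspace T = arrows G"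
    and Hausdorff_units: "Hausdorff_space (subtopology T (gunits G))"
    and one_cancel: "one_cancellative TYPE('y)"
    and semigroup: "fun_semigroup G T S"
    and bumpy: "bumpy G T S"
begin

lemma one_cancel_right: "(x::'y) * y = x \<Longrightarrow> y = 1"
  using one_cancel unfolding one_cancellative_def by blast

lemma one_cancel_left: "y * (x::'y) = x \<Longrightarrow> y = 1"
  using one_cancel unfolding one_cancellative_def by blast

lemma dom_bisection: "a \<in> S \<Longrightarrow> bisection G (dom a)"
  using bumpy by (auto simp: bumpy_def funs_on_def open_bisections_def)

lemma dom_open: "a \<in> S \<Longrightarrow> openin T (dom a)"
  using bumpy by (auto simp: bumpy_def funs_on_def open_bisections_def)

lemma dom_arrows: "a \<in> S \<Longrightarrow> g \<in> dom a \<Longrightarrow> g \<in> arrows G"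
  using dom_bisection[of a] unfolding bisection_def by blast

lemma fun_mult_closed: "a \<in> S \<Longrightarrow> b \<in> S \<Longrightarrow> fun_mult G a b \<in> S"
  using semigroup by (auto simp: fun_semigroup_def)

lemma empty_in: "Map.empty \<in> S"
  using bumpy by (simp add: bumpy_def urysohn_def)

lemma bumps_at_dom: "a \<in> bumps_at T S g \<Longrightarrow> g \<in> dom a"
  using interior_of_subset[of T "values_in invertibles a"] by (auto simp: bumps_at_def values_in_def)

lemma bumps_at_in: "a \<in> bumps_at T S g \<Longrightarrow> a \<in> S"
  by (simp add: bumps_at_def)

lemma bump_in_open:
  assumes "openin T U" "g \<in> U"
  obtains a where "a \<in> bumps_at T S g" "dom a \<subseteq> U"
proof -
  have "\<exists>a\<in>S. dom a \<subseteq> U \<and> g \<in> T interior_of (values_in invertibles a)"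
    using bumpy assms by (simp add: bumpy_def urysohn_def)
  then show thesis using that by (auto simp: bumps_at_def)
qed

lemma local_inverse:
  assumes "a \<in> bumps_at T S g"
  obtains b where "b \<in> S" "ginv G g \<in> T interior_of (inverse_agree G a b)"
proof -
  have "\<exists>b\<in>S. ginv G g \<in> T interior_of (inverse_agree G a b)"
    using bumpy assms by (simp add: bumpy_def involutive_def bumps_at_def)
  then show thesis using that by blast
qed

lemma inverse_agreeD:
  assumes "h \<in> inverse_agree G a b"
  shows "h \<in> arrows G" "ginv G h \<in> dom a" "h \<in> dom b"
    "the (a (ginv G h)) * the (b h) = 1" "the (b h) * the (a (ginv G h)) = 1"
  using assms unfolding inverse_agree_def by force+

text \<open>The involutive axiom is what makes inversion continuous: the local inverse of a bump lives on
  a neighbourhood whose inverse is contained in the domain of the bump.\<close>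

lemma openin_inv_image:
  assumes U: "openin T U"
  shows "openin T (ginv G ` U)"
proof (subst openin_subopen, intro ballI)
  fix k assume "k \<in> ginv G ` U"
  then obtain g where g: "g \<in> U" "k = ginv G g" by blast
  from U g(1) obtain a where a: "a \<in> bumps_at T S g" "dom a \<subseteq> U"
    by (rule bump_in_open)
  from a(1) obtain b where b: "b \<in> S" "ginv G g \<in> T interior_of (inverse_agree G a b)"
    by (rule local_inverse)
  have "h \<in> ginv G ` U" if "h \<in> T interior_of (inverse_agree G a b)" for h
  proof -
    have h: "h \<in> inverse_agree G a b" using that interior_of_subset by fastforce
    then have "h = ginv G (ginv G h)" using inverse_agreeD(1) inv_inv by fastforce
    then show ?thesis using inverse_agreeD(2)[OF h] a(2) by blast
  qed
  then show "\<exists>V. openin T V \<and> k \<in> V \<and> V \<subseteq> ginv G ` U"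
    using b(2) g(2) openin_interior_of by blast
qed

text \<open>Multiplication is an open map because the domain of a product of two bumps is open, the
  product being again an element of the semigroup.\<close>

lemma openin_set_mult:
  assumes A: "openin T A" and B: "openin T B"
  shows "openin T (set_mult G A B)"
proof (subst openin_subopen, intro ballI)
  fix k assume "k \<in> set_mult G A B"
  then obtain g h where gh: "g \<in> A" "h \<in> B" "composable G g h" "k = gmult G g h"
    by (auto simp: set_mult_def)
  from A gh(1) obtain a where a: "a \<in> bumps_at T S g" "dom a \<subseteq> A"
    by (rule bump_in_open)
  from B gh(2) obtain b where b: "b \<in> bumps_at T S h" "dom b \<subseteq> B"
    by (rule bump_in_open)
  have "openin T (set_mult G (dom a) (dom b))"
    using dom_open[OF fun_mult_closed[OF bumps_at_in[OF a(1)] bumps_at_in[OF b(1)]]]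
    by (simp add: dom_fun_mult)
  moreover have "k \<in> set_mult G (dom a) (dom b)"
    using bumps_at_dom[OF a(1)] bumps_at_dom[OF b(1)] gh by (auto simp: set_mult_def)
  moreover have "set_mult G (dom a) (dom b) \<subseteq> set_mult G A B"
    using a(2) b(2) unfolding set_mult_def by blast
  ultimately show "\<exists>V. openin T V \<and> k \<in> V \<and> V \<subseteq> set_mult G A B" by blast
qed

lemma openin_units: "openin T (gunits G)"
proof (subst openin_subopen, intro ballI)
  fix u assume "u \<in> gunits G"
  then obtain g where g: "g \<in> arrows G" "u = src G g" by (auto simp: gunits_def)
  have "openin T (arrows G)" using openin_topspace[of T] by (simp add: topspace_arrows)
  then obtain a where a: "a \<in> bumps_at T S g" using g(1) by (rule bump_in_open)
  let ?V = "set_mult G (ginv G ` dom a) (dom a)"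
  have "openin T ?V"
    using dom_open[OF bumps_at_in[OF a]] by (intro openin_set_mult openin_inv_image)
  moreover have "u \<in> ?V"
    using bumps_at_dom[OF a] g composable_inv_left[of g]
    by (auto simp: set_mult_def src_def)
  moreover have "?V \<subseteq> gunits G"
    using dom_bisection[OF bumps_at_in[OF a]] by (simp add: bisection_def)
  ultimately show "\<exists>V. openin T V \<and> u \<in> V \<and> V \<subseteq> gunits G" by blast
qed

text \<open>The preimage of \<open>O\<close> under the source map is the product of \<open>G\<close> with the set of units in \<open>O\<close>.\<close>

lemma continuous_src: "continuous_map T T (src G)"
  unfolding continuous_map topspace_arrows
proof (intro conjI allI impI)
  show "src G ` arrows G \<subseteq> arrows G" using src_closed by blast
  fix U assume U: "openin T U"
  have "{g \<in> arrows G. src G g \<in> U} = set_mult G (arrows G) (U \<inter> gunits G)"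
  proof (intro equalityI subsetI)
    fix g assume "g \<in> {g \<in> arrows G. src G g \<in> U}"
    then show "g \<in> set_mult G (arrows G) (U \<inter> gunits G)"
      unfolding set_mult_def using composable_src[of g] mult_src[of g] src_in_units[of g]
      by force
  next
    fix g assume "g \<in> set_mult G (arrows G) (U \<inter> gunits G)"
    then obtain h u where "h \<in> arrows G" "u \<in> U" "u \<in> gunits G" "composable G h u"
      "g = gmult G h u" by (auto simp: set_mult_def)
    then show "g \<in> {g \<in> arrows G. src G g \<in> U}" using mult_unit[of u h] by simp
  qed
  then show "openin T {g \<in> arrows G. src G g \<in> U}"
    using openin_set_mult[OF openin_topspace openin_Int[OF U openin_units]]
    by (simp add: topspace_arrows)
qed

text \<open>The source map is open as \<open>g\<inverse>h\<close> is a unit only for \<open>g = h\<close>, whence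
  \<open>src[U] = U\<inverse>U \<inter> G\<^sup>0\<close>.\<close>

lemma openin_src_image:
  assumes U: "openin T U"
  shows "openin T (src G ` U)"
proof -
  have arr: "U \<subseteq> arrows G" using openin_subset[OF U] by (simp add: topspace_arrows)
  have "src G ` U = set_mult G (ginv G ` U) U \<inter> gunits G"
  proof (intro equalityI subsetI)
    fix u assume "u \<in> src G ` U"
    then show "u \<in> set_mult G (ginv G ` U) U \<inter> gunits G"
      using arr composable_inv_left src_in_units by (auto simp: set_mult_def src_def)
  next
    fix u assume "u \<in> set_mult G (ginv G ` U) U \<inter> gunits G"
    then obtain g h where gh: "g \<in> U" "h \<in> U" "composable G (ginv G g) h"
      "u = gmult G (ginv G g) h" "u \<in> gunits G" by (auto simp: set_mult_def)
    then have "h = g" using inv_eq_of_mult_unit[OF gh(3)] arr inv_inv by auto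
    then show "u \<in> src G ` U" using gh by (auto simp: src_def)
  qed
  then show ?thesis
    using openin_set_mult[OF openin_inv_image[OF U] U] openin_units by (simp add: openin_Int)
qed

lemma homeomorphic_src_bisection:
  assumes B: "openin T B" "bisection G B"
  shows "homeomorphic_map (subtopology T B) (subtopology T (src G ` B)) (src G)"
proof (rule bijective_open_imp_homeomorphic_map)
  have arr: "B \<subseteq> topspace T" using openin_subset[OF B(1)] .
  have img: "src G ` B \<subseteq> topspace T" using openin_subset[OF openin_src_image[OF B(1)]] .
  show "continuous_map (subtopology T B) (subtopology T (src G ` B)) (src G)"
    using arr by (auto simp: continuous_map_in_subtopology
        intro: continuous_map_from_subtopology continuous_src)
  show "open_map (subtopology T B) (subtopology T (src G ` B)) (src G)"
    unfolding open_map_def using B(1) openin_src_image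
    by (auto simp: openin_open_subtopology)
  show "src G ` topspace (subtopology T B) = topspace (subtopology T (src G ` B))"
    using arr img by (auto simp: topspace_subtopology)
  show "inj_on (src G) (topspace (subtopology T B))"
    using bisection_src_inj[OF B(2)] by (auto simp: inj_on_def)
qed

lemma Hausdorff_bisection:
  assumes B: "openin T B" "bisection G B"
  shows "Hausdorff_space (subtopology T B)"
proof -
  have "src G ` B \<subseteq> gunits G" using B(2) by (auto simp: bisection_def gunits_def)
  then have "Hausdorff_space (subtopology T (src G ` B))"
    using Hausdorff_space_subtopology[OF Hausdorff_units, of "src G ` B"]
    by (simp add: subtopology_subtopology Int_absorb1)
  then show ?thesis
    using homeomorphic_Hausdorff_space homeomorphic_map_imp_homeomorphic_space
      homeomorphic_src_bisection[OF B] by blast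
qed

text \<open>Although \<open>G\<close> need not be Hausdorff, points are determined by their bumps: if all bumps at \<open>g\<close>
  are bumps at \<open>h\<close>, then both points lie in one open bisection, which is Hausdorff.\<close>

lemma bumps_at_subset_imp_eq:
  assumes g: "g \<in> arrows G" and sub: "bumps_at T S g \<subseteq> bumps_at T S h"
  shows "g = h"
proof (rule ccontr)
  assume neq: "g \<noteq> h"
  have "openin T (arrows G)" using openin_topspace[of T] by (simp add: topspace_arrows)
  then obtain a where a: "a \<in> bumps_at T S g" using g by (rule bump_in_open)
  have in_dom: "g \<in> dom a" "h \<in> dom a" using a sub bumps_at_dom by auto
  note op = dom_open[OF bumps_at_in[OF a]]
  have "Hausdorff_space (subtopology T (dom a))"
    using op dom_bisection[OF bumps_at_in[OF a]] by (rule Hausdorff_bisection)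
  moreover have "g \<in> topspace (subtopology T (dom a))" "h \<in> topspace (subtopology T (dom a))"
    using in_dom openin_subset[OF op] by auto
  ultimately obtain U V where UV: "openin (subtopology T (dom a)) U" "g \<in> U" "h \<in> V"
    "disjnt U V" using neq unfolding Hausdorff_space_def by metis
  have "openin T U" using UV(1) op by (simp add: openin_open_subtopology)
  then obtain b where b: "b \<in> bumps_at T S g" "dom b \<subseteq> U" using UV(2) by (rule bump_in_open)
  then have "h \<in> U" using sub bumps_at_dom by blast
  then show False using UV by (auto simp: disjnt_iff)
qed

end

section \<open>Domination\<close>

lemma map_eqI:
  assumes "dom f \<subseteq> dom g" "\<And>x. x \<in> dom g \<Longrightarrow> f x = g x"
  shows "f = g"
  using assms by (intro ext) (metis domIff subsetD)

text \<open>Domination of \<open>a\<close> by \<open>b\<close> says that some \<open>s\<close> inverts \<open>b\<close> on the domain of \<open>a\<close>. It is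
  expressed through products and the diagonal alone, so that every diagonal-preserving isomorphism
  respects it.\<close>

definition dominated ::
    "'g groupoid_data \<Rightarrow> ('g \<rightharpoonup> 'y::monoid_mult) set \<Rightarrow> ('g \<rightharpoonup> 'y) \<Rightarrow> ('g \<rightharpoonup> 'y) \<Rightarrow> bool" where
  "dominated G S a b \<longleftrightarrow> (\<exists>s\<in>S. fun_mult G a s \<in> diagonal G S \<and> fun_mult G s a \<in> diagonal G S \<and>
     fun_mult G (fun_mult G a s) b = a \<and> fun_mult G b (fun_mult G s a) = a)"

context bumpy_semigroup
begin

text \<open>In \<open>a(g) = a(h) s(k) b(l)\<close> with \<open>g = hkl\<close>, the product \<open>hk\<close> is a unit, which forces
  \<open>k = h\<inverse>\<close>, then \<open>l = g\<close>, and \<open>h = g\<close> as \<open>g\<close> and \<open>h\<close> have the same range;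
  now cancel \<open>a(g)\<close>.\<close>

lemma left_domination_pointwise:
  assumes S: "a \<in> S" "s \<in> S" "b \<in> S"
    and D: "dom (fun_mult G a s) \<subseteq> gunits G"
    and eq: "fun_mult G (fun_mult G a s) b = a" and g: "g \<in> dom a"
  shows "ginv G g \<in> dom s \<and> g \<in> dom b \<and> the (s (ginv G g)) * the (b g) = 1"
proof -
  have "g \<in> dom (fun_mult G (fun_mult G a s) b)" using g eq by simp
  then obtain u l where u: "u \<in> dom (fun_mult G a s)" and l: "l \<in> dom b" "composable G u l"
    "g = gmult G u l" by (rule dom_fun_multE)
  have unit: "u \<in> gunits G" using u D by blast
  have lg: "l = g" and ug: "u = rng G g" using unit_mult[OF unit l(2)] l(3) by auto
  from u obtain h k where hk: "h \<in> dom a" "k \<in> dom s" "composable G h k" "u = gmult G h k"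
    by (rule dom_fun_multE)
  have k: "k = ginv G h" using inv_eq_of_mult_unit hk unit by blast
  have "rng G h = rng G g" using rng_product[OF hk(3)] hk(4) ug rng_unit[OF unit] by simp
  then have h: "h = g" using bisection_rng_inj[OF dom_bisection[OF S(1)] hk(1) g] by simp
  have "fun_mult G a s u = Some (the (a g) * the (s (ginv G g)))"
    using fun_mult_apply[OF dom_bisection[OF S(1)] hk(1-3)] hk(4) h k by simp
  moreover have "fun_mult G (fun_mult G a s) b g = Some (the (fun_mult G a s u) * the (b l))"
    using fun_mult_apply[OF dom_bisection[OF fun_mult_closed[OF S(1,2)]] u l(1,2)] l(3) by simp
  ultimately have "the (a g) * (the (s (ginv G g)) * the (b g)) = the (a g)"
    using eq lg by (simp add: mult.assoc) (metis option.sel)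
  then have "the (s (ginv G g)) * the (b g) = 1" by (rule one_cancel_right)
  then show ?thesis using hk(2) k h l(1) lg by simp
qed

lemma right_domination_pointwise:
  assumes S: "a \<in> S" "s \<in> S" "b \<in> S"
    and D: "dom (fun_mult G s a) \<subseteq> gunits G"
    and eq: "fun_mult G b (fun_mult G s a) = a" and g: "g \<in> dom a"
  shows "the (b g) * the (s (ginv G g)) = 1"
proof -
  have "g \<in> dom (fun_mult G b (fun_mult G s a))" using g eq by simp
  then obtain l u where u: "u \<in> dom (fun_mult G s a)" and l: "l \<in> dom b" "composable G l u"
    "g = gmult G l u" by (metis dom_fun_multE)
  have unit: "u \<in> gunits G" using u D by blast
  have lg: "l = g" and ug: "u = src G g" using mult_unit[OF unit l(2)] l(3) by auto
  from u obtain k h where hk: "k \<in> dom s" "h \<in> dom a" "composable G k h" "u = gmult G k h"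
    by (rule dom_fun_multE)
  have "src G h = src G g" using src_product[OF hk(3)] hk(4) ug src_unit[OF unit] by simp
  then have h: "h = g" using bisection_src_inj[OF dom_bisection[OF S(1)] hk(2) g] by simp
  have "k \<in> arrows G" using hk(3) by (simp add: composable_def)
  then have k: "k = ginv G g" using inv_eq_of_mult_unit[OF hk(3)] hk(4) unit h inv_inv by metis
  have "fun_mult G s a u = Some (the (s (ginv G g)) * the (a g))"
    using fun_mult_apply[OF dom_bisection[OF S(2)] hk(1-3)] hk(4) h k by simp
  moreover have "fun_mult G b (fun_mult G s a) g = Some (the (b l) * the (fun_mult G s a u))"
    using fun_mult_apply[OF dom_bisection[OF S(3)] l(1) u l(2)] l(3) by simp
  ultimately have "(the (b g) * the (s (ginv G g))) * the (a g) = the (a g)"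
    using eq lg by (simp add: mult.assoc) (metis option.sel)
  then show ?thesis by (rule one_cancel_left)
qed

lemma dominated_bump:
  assumes ab: "a \<in> S" "b \<in> S" "dominated G S a b" and g: "g \<in> dom a"
  shows "b \<in> bumps_at T S g"
proof -
  from ab(3) obtain s where s: "s \<in> S" "dom (fun_mult G a s) \<subseteq> gunits G"
    "dom (fun_mult G s a) \<subseteq> gunits G" "fun_mult G (fun_mult G a s) b = a"
    "fun_mult G b (fun_mult G s a) = a" unfolding dominated_def diagonal_def by blast
  have "dom a \<subseteq> values_in invertibles b"
  proof
    fix h assume h: "h \<in> dom a"
    from left_domination_pointwise[OF ab(1) s(1) ab(2) s(2,4) h]
      right_domination_pointwise[OF ab(1) s(1) ab(2) s(3,5) h]
    show "h \<in> values_in invertibles b" unfolding values_in_def invertibles_def by blast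
  qed
  then have "dom a \<subseteq> T interior_of (values_in invertibles b)"
    using dom_open[OF ab(1)] by (rule interior_of_maximal)
  then show ?thesis using g ab(2) by (auto simp: bumps_at_def)
qed

lemma dominated_dom_subset:
  assumes "a \<in> S" "b \<in> S" "dominated G S a b"
  shows "dom a \<subseteq> dom b"
  using dominated_bump[OF assms] bumps_at_dom by blast

text \<open>Here 1-properness enters. If \<open>s\<close> witnesses the domination then \<open>sb\<close> has value \<open>1\<close> at the source
  of every point of \<open>dom a\<close>, so these sources lie in the compact set \<open>C = [1](sb)\<close>. This set may
  leave \<open>G\<^sup>0\<close>, but its image \<open>src[C]\<close> is a compact set of sources of points in \<open>dom b\<close>, and
  the homeomorphism \<open>src\<close> lifts it back to \<open>dom b\<close>.\<close>

lemma dominated_compact_between: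
  assumes ab: "a \<in> S" "b \<in> S" "dominated G S a b"
  obtains K where "compactin T K" "dom a \<subseteq> K" "K \<subseteq> dom b"
proof -
  from ab(3) obtain s where s: "s \<in> S" "dom (fun_mult G a s) \<subseteq> gunits G"
    "fun_mult G (fun_mult G a s) b = a" unfolding dominated_def diagonal_def by blast
  define C where "C = values_in {1} (fun_mult G s b)"
  define K where "K = {g \<in> dom b. src G g \<in> src G ` C}"
  have sb: "fun_mult G s b \<in> S" using s(1) ab(2) by (rule fun_mult_closed)
  have C: "compactin T C"
    using bumpy sb unfolding bumpy_def one_proper_def C_def by blast
  have sub: "src G ` C \<subseteq> src G ` dom b"
  proof
    fix u assume "u \<in> src G ` C"
    then obtain c where c: "c \<in> dom (fun_mult G s b)" "u = src G c"
      by (auto simp: C_def values_in_def)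
    from c(1) obtain k l where "l \<in> dom b" "composable G k l" "c = gmult G k l"
      by (rule dom_fun_multE)
    then show "u \<in> src G ` dom b" using c(2) src_product by simp
  qed
  have "compactin T (src G ` C)" using C continuous_src by (rule image_compactin)
  then have "compactin (subtopology T (src G ` dom b)) (src G ` C)"
    using sub by (simp add: compactin_subtopology)
  moreover have "src G ` K = src G ` C"
  proof (intro equalityI subsetI)
    fix u assume u: "u \<in> src G ` C"
    then obtain g where "g \<in> dom b" "u = src G g" using sub by blast
    then show "u \<in> src G ` K" using u by (simp add: K_def)
  qed (auto simp: K_def)
  moreover have "K \<subseteq> topspace (subtopology T (dom b))"
    using openin_subset[OF dom_open[OF ab(2)]] by (auto simp: K_def)
  ultimately have "compactin (subtopology T (dom b)) K"
    using homeomorphic_map_compactness[OF homeomorphic_src_bisection[OF dom_open[OF ab(2)]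
        dom_bisection[OF ab(2)]], of K] by metis
  then have "compactin T K" by (simp add: compactin_subtopology)
  moreover have "K \<subseteq> dom b" by (auto simp: K_def)
  moreover have "dom a \<subseteq> K"
  proof
    fix g assume g: "g \<in> dom a"
    from left_domination_pointwise[OF ab(1) s(1) ab(2) s(2,3) g]
    have p: "ginv G g \<in> dom s" "g \<in> dom b" "the (s (ginv G g)) * the (b g) = 1" by auto
    have arr: "g \<in> arrows G" using dom_arrows[OF ab(1) g] .
    have "fun_mult G s b (src G g) = Some 1"
      using fun_mult_apply[OF dom_bisection[OF s(1)] p(1,2) composable_inv_left[OF arr]] p(3)
      by (simp add: src_def)
    then have "src G g \<in> C" by (auto simp: C_def values_in_def)
    then have "src G g \<in> src G ` C" using src_src[OF arr] by (metis imageI)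
    then show "g \<in> K" using p(2) by (simp add: K_def)
  qed
  ultimately show thesis using that by blast
qed

text \<open>If \<open>b\<close> is invertible near \<open>g\<close>, a local inverse \<open>s\<close> of \<open>b\<close> witnesses that \<open>b\<close> dominates
  everything with small enough domain.\<close>

lemma dominated_near:
  assumes b: "b \<in> bumps_at T S g" and g: "g \<in> arrows G"
  obtains N where "openin T N" "g \<in> N" "\<And>a. a \<in> S \<Longrightarrow> dom a \<subseteq> N \<Longrightarrow> dominated G S a b"
proof -
  from b obtain s where s: "s \<in> S" "ginv G g \<in> T interior_of (inverse_agree G b s)"
    by (rule local_inverse)
  define N where "N = ginv G ` (T interior_of (inverse_agree G b s))"
  have "openin T N" unfolding N_def by (intro openin_inv_image openin_interior_of)
  moreover have "g \<in> N" unfolding N_def using s(2) inv_inv[OF g] by force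
  moreover have "dominated G S a b" if a: "a \<in> S" "dom a \<subseteq> N" for a
  proof -
    note bS = bumps_at_in[OF b]
    note bis = dom_bisection[OF a(1)] dom_bisection[OF s(1)] dom_bisection[OF bS]
    have N: "h \<in> arrows G" "ginv G h \<in> dom s" "h \<in> dom b"
      "the (b h) * the (s (ginv G h)) = 1" "the (s (ginv G h)) * the (b h) = 1"
      if "h \<in> dom a" for h
    proof -
      from that a(2) obtain k where k0: "k \<in> T interior_of (inverse_agree G b s)"
        and h: "h = ginv G k" unfolding N_def by blast
      have "k \<in> inverse_agree G b s"
        using k0 interior_of_subset[of T "inverse_agree G b s"] by blast
      note k = inverse_agreeD[OF this]
      have "ginv G h = k" using h inv_inv[OF k(1)] by simp
      with k h show "h \<in> arrows G" "ginv G h \<in> dom s" "h \<in> dom b"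
        "the (b h) * the (s (ginv G h)) = 1" "the (s (ginv G h)) * the (b h) = 1"
        using inv_closed[OF k(1)] by auto
    qed
    \<comment> \<open>As \<open>dom s\<close> is a bisection containing all \<open>h\<inverse>\<close>, these are its only elements that
      compose with \<open>dom a\<close>; therefore \<open>as\<close> and \<open>sa\<close> live on units.\<close>
    have as_fact: "k = ginv G h" if "h \<in> dom a" "k \<in> dom s" "composable G h k" for h k
    proof -
      have "rng G k = rng G (ginv G h)" using that N(1) rng_inv by (simp add: composable_def)
      then show ?thesis using bisection_rng_inj[OF bis(2)] that N(2) by blast
    qed
    have sa_fact: "k = ginv G h" if "h \<in> dom a" "k \<in> dom s" "composable G k h" for h k
    proof -
      have "src G k = src G (ginv G h)" using that N(1) src_inv by (simp add: composable_def)
      then show ?thesis using bisection_src_inj[OF bis(2)] that N(2) by blast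
    qed
    have as_val: "fun_mult G a s (rng G h) = Some (the (a h) * the (s (ginv G h)))"
      if "h \<in> dom a" for h
      using fun_mult_apply[OF bis(1) that N(2)[OF that] composable_inv_right[OF N(1)[OF that]]]
      by (simp add: rng_def)
    have sa_val: "fun_mult G s a (src G h) = Some (the (s (ginv G h)) * the (a h))"
      if "h \<in> dom a" for h
      using fun_mult_apply[OF bis(2) N(2)[OF that] that composable_inv_left[OF N(1)[OF that]]]
      by (simp add: src_def)
    have as_dom: "dom (fun_mult G a s) = rng G ` dom a"
    proof (intro equalityI subsetI)
      fix u assume "u \<in> dom (fun_mult G a s)"
      then obtain h k where "h \<in> dom a" "k \<in> dom s" "composable G h k" "u = gmult G h k"
        by (rule dom_fun_multE)
      then have "h \<in> dom a" "u = rng G h" using as_fact by (auto simp: rng_def)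
      then show "u \<in> rng G ` dom a" by blast
    qed (use as_val in blast)
    have sa_dom: "dom (fun_mult G s a) = src G ` dom a"
    proof (intro equalityI subsetI)
      fix u assume "u \<in> dom (fun_mult G s a)"
      then obtain k h where "k \<in> dom s" "h \<in> dom a" "composable G k h" "u = gmult G k h"
        by (rule dom_fun_multE)
      then have "h \<in> dom a" "u = src G h" using sa_fact by (auto simp: src_def)
      then show "u \<in> src G ` dom a" by blast
    qed (use sa_val in blast)
    have "rng G ` dom a \<subseteq> gunits G" "src G ` dom a \<subseteq> gunits G"
      using N(1) rng_in_units src_in_units by blast+
    then have "fun_mult G a s \<in> diagonal G S" "fun_mult G s a \<in> diagonal G S"
      using fun_mult_closed a(1) s(1) as_dom sa_dom by (simp_all add: diagonal_def)
    moreover have "fun_mult G (fun_mult G a s) b = a"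
    proof -
      have bis_as: "bisection G (dom (fun_mult G a s))"
        using dom_bisection[OF fun_mult_closed[OF a(1) s(1)]] .
      have val: "fun_mult G (fun_mult G a s) b h = a h" if h: "h \<in> dom a" for h
      proof -
        have "rng G h \<in> dom (fun_mult G a s)" using h as_dom by blast
        then have "fun_mult G (fun_mult G a s) b (gmult G (rng G h) h) =
            Some (the (fun_mult G a s (rng G h)) * the (b h))"
          using fun_mult_apply[OF bis_as _ N(3)[OF h] composable_rng[OF N(1)[OF h]]] by blast
        also have "\<dots> = a h" using as_val[OF h] N(5)[OF h] h by (auto simp: mult.assoc)
        finally show ?thesis using rng_mult[OF N(1)[OF h]] by simp
      qed
      have "dom (fun_mult G (fun_mult G a s) b) \<subseteq> dom a"
      proof
        fix x assume "x \<in> dom (fun_mult G (fun_mult G a s) b)"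
        then obtain u l where ul: "u \<in> dom (fun_mult G a s)" "l \<in> dom b" "composable G u l"
          "x = gmult G u l" by (rule dom_fun_multE)
        from ul(1) as_dom obtain h where h: "h \<in> dom a" "u = rng G h" by blast
        have u: "u \<in> gunits G" using h N(1) rng_in_units by blast
        have "rng G l = rng G h" using unit_mult(1)[OF u ul(3)] h(2) by simp
        then have "l = h" using bisection_rng_inj[OF bis(3) ul(2) N(3)[OF h(1)]] by simp
        then show "x \<in> dom a" using unit_mult(2)[OF u ul(3)] ul(4) h(1) by simp
      qed
      then show ?thesis using val by (rule map_eqI)
    qed
    moreover have "fun_mult G b (fun_mult G s a) = a"
    proof -
      have val: "fun_mult G b (fun_mult G s a) h = a h" if h: "h \<in> dom a" for h
      proof -
        have "src G h \<in> dom (fun_mult G s a)" using h sa_dom by blast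
        then have "fun_mult G b (fun_mult G s a) (gmult G h (src G h)) =
            Some (the (b h) * the (fun_mult G s a (src G h)))"
          using fun_mult_apply[OF bis(3) N(3)[OF h] _ composable_src[OF N(1)[OF h]]] by blast
        also have "\<dots> = a h"
          using sa_val[OF h] N(4)[OF h] h by (auto simp: mult.assoc[symmetric])
        finally show ?thesis using mult_src[OF N(1)[OF h]] by simp
      qed
      have "dom (fun_mult G b (fun_mult G s a)) \<subseteq> dom a"
      proof
        fix x assume "x \<in> dom (fun_mult G b (fun_mult G s a))"
        then obtain l u where ul: "l \<in> dom b" "u \<in> dom (fun_mult G s a)" "composable G l u"
          "x = gmult G l u" by (rule dom_fun_multE)
        from ul(2) sa_dom obtain h where h: "h \<in> dom a" "u = src G h" by blast
        have u: "u \<in> gunits G" using h N(1) src_in_units by blast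
        have "src G l = src G h" using mult_unit(1)[OF u ul(3)] h(2) by simp
        then have "l = h" using bisection_src_inj[OF bis(3) ul(1) N(3)[OF h(1)]] by simp
        then show "x \<in> dom a" using mult_unit(2)[OF u ul(3)] ul(4) h(1) by simp
      qed
      then show ?thesis using val by (rule map_eqI)
    qed
    ultimately show ?thesis unfolding dominated_def using s(1) by blast
  qed
  ultimately show thesis using that by blast
qed

lemma bumps_at_directed:
  assumes g: "g \<in> arrows G" and ab: "a \<in> bumps_at T S g" "b \<in> bumps_at T S g"
  obtains c where "c \<in> bumps_at T S g" "dominated G S c a" "dominated G S c b"
proof -
  obtain M where M: "openin T M" "g \<in> M" "\<And>c. c \<in> S \<Longrightarrow> dom c \<subseteq> M \<Longrightarrow> dominated G S c a"
    using dominated_near[OF ab(1) g] by blast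
  obtain N where N: "openin T N" "g \<in> N" "\<And>c. c \<in> S \<Longrightarrow> dom c \<subseteq> N \<Longrightarrow> dominated G S c b"
    using dominated_near[OF ab(2) g] by blast
  obtain c where "c \<in> bumps_at T S g" "dom c \<subseteq> M \<inter> N"
    using bump_in_open[OF openin_Int[OF M(1) N(1)]] M(2) N(2) by blast
  then show thesis using that M(3) N(3) bumps_at_in by blast
qed

lemma bumps_at_nonempty:
  assumes "g \<in> arrows G"
  obtains a where "a \<in> bumps_at T S g"
proof -
  have "openin T (arrows G)" using openin_topspace[of T] by (simp add: topspace_arrows)
  then show thesis using assms that bump_in_open by blast
qed

text \<open>Compactness gives a common point. Compact sets need not be closed in \<open>G\<close>, so the argument
  takes place in the Hausdorff domain of a fixed \<open>a\<close> in the filter, where those compact sets that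
  contain the domain of some member of the filter have the finite intersection property.\<close>

lemma dominated_filter_has_point:
  assumes sub: "F \<subseteq> S" and ne: "F \<noteq> {}" and proper: "Map.empty \<notin> F"
    and directed: "\<And>a b. a \<in> F \<Longrightarrow> b \<in> F \<Longrightarrow> \<exists>c\<in>F. dominated G S c a \<and> dominated G S c b"
  obtains h where "\<And>a. a \<in> F \<Longrightarrow> h \<in> dom a"
proof -
  obtain a where a: "a \<in> F" using ne by blast
  define X where "X = subtopology T (dom a)"
  define \<K> where "\<K> = {K. compactin X K \<and> (\<exists>c\<in>F. dom c \<subseteq> K)}"
  have "Hausdorff_space X"
    unfolding X_def using a sub by (intro Hausdorff_bisection dom_open dom_bisection) auto
  then have closed: "closedin X K" if "K \<in> \<K>" for K
    using that compactin_imp_closedin by (auto simp: \<K>_def)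
  have small: "\<exists>K\<in>\<K>. K \<subseteq> dom b" if b: "b \<in> F" for b
  proof -
    \<comment> \<open>Two steps are needed: the compact set below \<open>b\<close> must also lie in \<open>dom a\<close>.\<close>
    obtain c where c: "c \<in> F" "dominated G S c a" "dominated G S c b"
      using directed[OF a b] by blast
    obtain d where d: "d \<in> F" "dominated G S d c" using directed[OF c(1) c(1)] by blast
    obtain K where K: "compactin T K" "dom d \<subseteq> K" "K \<subseteq> dom c"
      using dominated_compact_between[OF _ _ d(2)] c(1) d(1) sub by blast
    have "dom c \<subseteq> dom a" "dom c \<subseteq> dom b"
      using dominated_dom_subset a b c sub by blast+
    then have "K \<in> \<K>" "K \<subseteq> dom b"
      using K d(1) unfolding \<K>_def X_def compactin_subtopology by blast+
    then show ?thesis by blast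
  qed
  have fip: "\<exists>c\<in>F. \<forall>K\<in>\<F>. dom c \<subseteq> K" if "finite \<F>" "\<F> \<subseteq> \<K>" for \<F>
    using that
  proof (induction \<F> rule: finite_induct)
    case empty
    then show ?case using a by blast
  next
    case (insert K \<F>)
    then obtain b c where b: "b \<in> F" "\<forall>L\<in>\<F>. dom b \<subseteq> L" and c: "c \<in> F" "dom c \<subseteq> K"
      by (auto simp: \<K>_def)
    obtain d where d: "d \<in> F" "dominated G S d b" "dominated G S d c"
      using directed[OF b(1) c(1)] by blast
    have "dom d \<subseteq> dom b" "dom d \<subseteq> dom c" using dominated_dom_subset b c d sub by blast+
    then show ?case using b c d(1) by blast
  qed
  have nonempty: "dom c \<noteq> {}" if "c \<in> F" for c using that proper by auto
  obtain K0 where K0: "K0 \<in> \<K>" using small[OF a] by blast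
  have "K0 \<inter> \<Inter>\<K> \<noteq> {}"
  proof -
    have "K0 \<inter> \<Inter>\<F> \<noteq> {}" if "finite \<F>" "\<F> \<subseteq> \<K>" for \<F>
      using fip[of "insert K0 \<F>"] that K0 nonempty by fastforce
    moreover have "compactin X K0" using K0 by (simp add: \<K>_def)
    ultimately show ?thesis using closed by (simp add: compactin_fip)
  qed
  then obtain h where h: "h \<in> \<Inter>\<K>" by blast
  have "h \<in> dom b" if "b \<in> F" for b using small[OF that] h by blast
  then show thesis using that by blast
qed

text \<open>The product of bumps is invertible on the product of the two open sets on which the factors
  are invertible.\<close>

lemma bumps_at_mult:
  assumes a: "a \<in> bumps_at T S g" and b: "b \<in> bumps_at T S h" and gh: "composable G g h"
  shows "fun_mult G a b \<in> bumps_at T S (gmult G g h)"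
proof -
  let ?A = "T interior_of (values_in invertibles a)"
  let ?B = "T interior_of (values_in invertibles b)"
  have "set_mult G ?A ?B \<subseteq> values_in invertibles (fun_mult G a b)"
  proof
    fix x assume "x \<in> set_mult G ?A ?B"
    then obtain k l where kl: "k \<in> ?A" "l \<in> ?B" "composable G k l" "x = gmult G k l"
      by (auto simp: set_mult_def)
    then have "k \<in> values_in invertibles a" "l \<in> values_in invertibles b"
      using interior_of_subset by fastforce+
    then have k: "k \<in> dom a" "the (a k) \<in> invertibles"
      and l: "l \<in> dom b" "the (b l) \<in> invertibles" by (auto simp: values_in_def)
    have val: "fun_mult G a b x = Some (the (a k) * the (b l))"
      using fun_mult_apply[OF dom_bisection[OF bumps_at_in[OF a]] k(1) l(1) kl(3)] kl(4) by simp
    obtain y z where "the (a k) * y = 1" "y * the (a k) = 1" "the (b l) * z = 1"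
      "z * the (b l) = 1" using k(2) l(2) by (auto simp: invertibles_def)
    then have "the (a k) * the (b l) * (z * y) = 1" "z * y * (the (a k) * the (b l)) = 1"
      by (metis mult.assoc mult_1_right)+
    then have "the (a k) * the (b l) \<in> invertibles" unfolding invertibles_def by blast
    then show "x \<in> values_in invertibles (fun_mult G a b)"
      using val by (auto simp: values_in_def)
  qed
  then have "set_mult G ?A ?B \<subseteq> T interior_of (values_in invertibles (fun_mult G a b))"
    by (intro interior_of_maximal openin_set_mult openin_interior_of)
  moreover have "gmult G g h \<in> set_mult G ?A ?B"
    using a b gh by (auto simp: bumps_at_def set_mult_def)
  ultimately show ?thesis
    using fun_mult_closed a b by (auto simp: bumps_at_def)
qed

end

section \<open>The point map induced by an isomorphism\<close>

locale diagonal_iso =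
  source: bumpy_semigroup G T S + target: bumpy_semigroup G' T' S'
  for G :: "'g groupoid_data" and T :: "'g topology" and S :: "('g \<rightharpoonup> 'y::monoid_mult) set"
    and G' :: "'h groupoid_data" and T' :: "'h topology" and S' :: "('h \<rightharpoonup> 'z::monoid_mult) set" +
  fixes \<phi> :: "('g \<rightharpoonup> 'y) \<Rightarrow> ('h \<rightharpoonup> 'z)"
  assumes iso: "fun_semigroup_iso G S G' S' \<phi>"
    and diag: "\<phi> ` diagonal G S = diagonal G' S'"
begin

lemma bij: "bij_betw \<phi> S S'"
  using iso by (simp add: fun_semigroup_iso_def)

lemma image_in: "a \<in> S \<Longrightarrow> \<phi> a \<in> S'"
  using bij by (auto simp: bij_betw_def)

lemma image_mult: "a \<in> S \<Longrightarrow> b \<in> S \<Longrightarrow> \<phi> (fun_mult G a b) = fun_mult G' (\<phi> a) (\<phi> b)"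
  using iso by (simp add: fun_semigroup_iso_def)

lemma inv_into_image: "a \<in> S \<Longrightarrow> inv_into S \<phi> (\<phi> a) = a"
  using bij by (simp add: bij_betw_def)

lemma image_inv_into: "b \<in> S' \<Longrightarrow> \<phi> (inv_into S \<phi> b) = b"
  using bij by (simp add: bij_betw_inv_into_right)

lemma inv_into_in: "b \<in> S' \<Longrightarrow> inv_into S \<phi> b \<in> S"
  using bij by (metis bij_betw_def inv_into_into)

text \<open>By symmetry, half of each claim about \<open>\<phi>\<close> and its point map follows from the other half.\<close>

lemma inverse_diagonal_iso: "diagonal_iso G' T' S' G T S (inv_into S \<phi>)"
proof (unfold_locales)
  have "inv_into S \<phi> (fun_mult G' a b) = fun_mult G (inv_into S \<phi> a) (inv_into S \<phi> b)"
    if ab: "a \<in> S'" "b \<in> S'" for a b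
  proof -
    note pre = ab[THEN inv_into_in]
    have "fun_mult G' a b = \<phi> (fun_mult G (inv_into S \<phi> a) (inv_into S \<phi> b))"
      using image_mult[OF pre] ab[THEN image_inv_into] by simp
    then show ?thesis using inv_into_image[OF source.fun_mult_closed[OF pre]] by simp
  qed
  then show "fun_semigroup_iso G' S' G S (inv_into S \<phi>)"
    using bij bij_betw_inv_into by (auto simp: fun_semigroup_iso_def)
  have "inv_into S \<phi> ` \<phi> ` diagonal G S = diagonal G S"
    by (rule inv_into_image_cancel) (use bij in \<open>auto simp: bij_betw_def diagonal_def\<close>)
  then show "inv_into S \<phi> ` diagonal G' S' = diagonal G S" using diag by simp
qed

lemma image_dominated:
  assumes ab: "a \<in> S" "b \<in> S" "dominated G S a b"
  shows "dominated G' S' (\<phi> a) (\<phi> b)"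
proof -
  obtain s where s: "s \<in> S" "fun_mult G a s \<in> diagonal G S" "fun_mult G s a \<in> diagonal G S"
    "fun_mult G (fun_mult G a s) b = a" "fun_mult G b (fun_mult G s a) = a"
    using ab(3) unfolding dominated_def by blast
  have "\<phi> (fun_mult G a s) \<in> diagonal G' S'" "\<phi> (fun_mult G s a) \<in> diagonal G' S'"
    using s diag by blast+
  moreover have "fun_mult G' (\<phi> (fun_mult G a s)) (\<phi> b) = \<phi> a"
    using image_mult[of "fun_mult G a s" b] source.fun_mult_closed s ab by simp
  moreover have "fun_mult G' (\<phi> b) (\<phi> (fun_mult G s a)) = \<phi> a"
    using image_mult[of b "fun_mult G s a"] source.fun_mult_closed s ab by simp
  ultimately show ?thesis
    unfolding dominated_def using s(1) ab image_in image_mult by (intro bexI[of _ "\<phi> s"]) auto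
qed

text \<open>The empty function is preserved, being the zero of the semigroup.\<close>

lemma image_empty: "\<phi> Map.empty = Map.empty"
proof -
  define e where "e = inv_into S \<phi> Map.empty"
  have e: "e \<in> S" "\<phi> e = Map.empty"
    using target.empty_in inv_into_in image_inv_into by (auto simp: e_def)
  have "fun_mult G Map.empty e = Map.empty" by (auto simp: fun_mult_def set_mult_def)
  then have "\<phi> Map.empty = fun_mult G' (\<phi> Map.empty) Map.empty"
    using image_mult[OF source.empty_in e(1)] e(2) by simp
  also have "\<dots> = Map.empty" by (auto simp: fun_mult_def set_mult_def)
  finally show ?thesis .
qed

lemma common_point_exists:
  assumes g: "g \<in> arrows G"
  shows "\<exists>h. \<forall>a\<in>bumps_at T S g. h \<in> dom (\<phi> a)"
proof -
  let ?F = "\<phi> ` bumps_at T S g"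
  have proper: "Map.empty \<notin> ?F"
  proof
    assume "Map.empty \<in> ?F"
    then obtain a where a: "a \<in> bumps_at T S g" "\<phi> a = Map.empty" by auto
    have "a = inv_into S \<phi> (\<phi> a)" using inv_into_image[OF source.bumps_at_in[OF a(1)]] by simp
    also have "\<dots> = Map.empty" using inv_into_image[OF source.empty_in] a(2) image_empty by simp
    finally show False using source.bumps_at_dom[OF a(1)] by simp
  qed
  have sub: "?F \<subseteq> S'" using image_in source.bumps_at_in by blast
  have ne: "?F \<noteq> {}" using source.bumps_at_nonempty[OF g] by blast
  have directed: "\<exists>c\<in>?F. dominated G' S' c a \<and> dominated G' S' c b"
    if "a \<in> ?F" "b \<in> ?F" for a b
  proof -
    from that obtain p q where pq: "p \<in> bumps_at T S g" "q \<in> bumps_at T S g" "a = \<phi> p" "b = \<phi> q"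
      by blast
    obtain c where c: "c \<in> bumps_at T S g" "dominated G S c p" "dominated G S c q"
      using source.bumps_at_directed[OF g pq(1,2)] .
    note in_S = pq(1,2)[THEN source.bumps_at_in] c(1)[THEN source.bumps_at_in]
    have "dominated G' S' (\<phi> c) a" "dominated G' S' (\<phi> c) b"
      using image_dominated in_S c pq(3,4) by auto
    then show ?thesis using c(1) by blast
  qed
  obtain h where "\<And>a. a \<in> ?F \<Longrightarrow> h \<in> dom a"
    using target.dominated_filter_has_point[OF sub ne proper directed] by blast
  then show ?thesis by blast
qed

lemma image_bumps_subset:
  assumes g: "g \<in> arrows G" and h: "\<forall>a\<in>bumps_at T S g. h \<in> dom (\<phi> a)"
  shows "\<phi> ` bumps_at T S g \<subseteq> bumps_at T' S' h"
proof (rule image_subsetI)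
  fix a assume a: "a \<in> bumps_at T S g"
  obtain c where c: "c \<in> bumps_at T S g" "dominated G S c a"
    using source.bumps_at_directed[OF g a a] .
  note in_S = c(1)[THEN source.bumps_at_in] a[THEN source.bumps_at_in]
  show "\<phi> a \<in> bumps_at T' S' h"
    using target.dominated_bump[OF in_S[THEN image_in] image_dominated[OF in_S c(2)] bspec[OF h c(1)]] .
qed

text \<open>Transporting the bumps at \<open>h\<close> back gives a point \<open>k\<close> of \<open>G\<close> with
  \<open>S\<^sub>g \<subseteq> \<phi>\<inverse>[S'\<^sub>h] \<subseteq> S\<^sub>k\<close>; bumps separate points, so \<open>k = g\<close> and both
  inclusions are equalities.\<close>

lemma image_bumps_eq:
  assumes g: "g \<in> arrows G" and h: "\<forall>a\<in>bumps_at T S g. h \<in> dom (\<phi> a)"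
  shows "\<phi> ` bumps_at T S g = bumps_at T' S' h" and "h \<in> arrows G'"
proof -
  interpret inv: diagonal_iso G' T' S' G T S "inv_into S \<phi>" by (rule inverse_diagonal_iso)
  obtain a where a: "a \<in> bumps_at T S g" using source.bumps_at_nonempty[OF g] .
  show h': "h \<in> arrows G'"
    using target.dom_arrows[OF image_in[OF source.bumps_at_in[OF a]] bspec[OF h a]] .
  note sub = image_bumps_subset[OF g h]
  obtain k where k: "\<forall>b\<in>bumps_at T' S' h. k \<in> dom (inv_into S \<phi> b)"
    using inv.common_point_exists[OF h'] ..
  note sub' = inv.image_bumps_subset[OF h' k]
  have "bumps_at T S g \<subseteq> bumps_at T S k"
  proof
    fix c assume c: "c \<in> bumps_at T S g"
    then have "inv_into S \<phi> (\<phi> c) \<in> bumps_at T S k" using sub sub' by blast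
    then show "c \<in> bumps_at T S k" using inv_into_image source.bumps_at_in[OF c] by simp
  qed
  then have "g = k" using source.bumps_at_subset_imp_eq[OF g] by blast
  have "bumps_at T' S' h \<subseteq> \<phi> ` bumps_at T S g"
  proof
    fix b assume b: "b \<in> bumps_at T' S' h"
    then have "inv_into S \<phi> b \<in> bumps_at T S g" using sub' \<open>g = k\<close> by blast
    then show "b \<in> \<phi> ` bumps_at T S g"
      using image_inv_into[OF target.bumps_at_in[OF b]] by force
  qed
  then show "\<phi> ` bumps_at T S g = bumps_at T' S' h" using sub by blast
qed

lemma induced_map_singleton:
  assumes g: "g \<in> arrows G"
  shows "{induced_map T S \<phi> g} = (\<Inter>a\<in>bumps_at T S g. dom (\<phi> a))"
proof -
  obtain h where h: "\<forall>a\<in>bumps_at T S g. h \<in> dom (\<phi> a)"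
    using common_point_exists[OF g] ..
  have "h' = h" if "\<forall>a\<in>bumps_at T S g. h' \<in> dom (\<phi> a)" for h'
    using image_bumps_eq[OF g that] image_bumps_eq[OF g h] target.bumps_at_subset_imp_eq by simp
  then have "(\<Inter>a\<in>bumps_at T S g. dom (\<phi> a)) = {h}" using h by blast
  then show ?thesis by (simp add: induced_map_def)
qed

lemma bumps_at_induced_map:
  assumes g: "g \<in> arrows G"
  shows "bumps_at T' S' (induced_map T S \<phi> g) = \<phi> ` bumps_at T S g"
    and "induced_map T S \<phi> g \<in> arrows G'"
proof -
  have "\<forall>a\<in>bumps_at T S g. induced_map T S \<phi> g \<in> dom (\<phi> a)"
    using induced_map_singleton[OF g] by blast
  from image_bumps_eq[OF g this]
  show "bumps_at T' S' (induced_map T S \<phi> g) = \<phi> ` bumps_at T S g"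
    and "induced_map T S \<phi> g \<in> arrows G'" by auto
qed

lemma induced_map_inverse:
  assumes g: "g \<in> arrows G"
  shows "induced_map T' S' (inv_into S \<phi>) (induced_map T S \<phi> g) = g"
proof -
  interpret inv: diagonal_iso G' T' S' G T S "inv_into S \<phi>" by (rule inverse_diagonal_iso)
  let ?k = "induced_map T' S' (inv_into S \<phi>) (induced_map T S \<phi> g)"
  have "bumps_at T S ?k = inv_into S \<phi> ` \<phi> ` bumps_at T S g"
    using inv.bumps_at_induced_map(1)[OF bumps_at_induced_map(2)[OF g]]
      bumps_at_induced_map(1)[OF g] by simp
  also have "\<dots> = bumps_at T S g"
    by (rule inv_into_image_cancel) (use bij in \<open>auto simp: bij_betw_def bumps_at_def\<close>)
  finally show ?thesis using source.bumps_at_subset_imp_eq[OF g, of ?k] by simp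
qed

lemma induced_map_inverse':
  assumes h: "h \<in> arrows G'"
  shows "induced_map T S \<phi> (induced_map T' S' (inv_into S \<phi>) h) = h"
proof -
  interpret inv: diagonal_iso G' T' S' G T S "inv_into S \<phi>" by (rule inverse_diagonal_iso)
  let ?g = "induced_map T' S' (inv_into S \<phi>) h"
  have g: "?g \<in> arrows G" by (rule inv.bumps_at_induced_map(2)[OF h])
  have "bumps_at T' S' (induced_map T S \<phi> ?g) = \<phi> ` inv_into S \<phi> ` bumps_at T' S' h"
    using bumps_at_induced_map(1)[OF g] inv.bumps_at_induced_map(1)[OF h] by simp
  also have "\<dots> = bumps_at T' S' h"
    by (rule image_inv_into_cancel) (use bij in \<open>auto simp: bij_betw_def bumps_at_def\<close>)
  finally show ?thesis
    using target.bumps_at_subset_imp_eq[OF h, of "induced_map T S \<phi> ?g"] by simp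
qed

text \<open>The sets on which members of the semigroup are invertible have interiors forming a basis, and
  \<open>\<phi>\<close> matches these bases.\<close>

lemma continuous_induced_map: "continuous_map T T' (induced_map T S \<phi>)"
  unfolding continuous_map
proof (intro conjI allI impI)
  show "induced_map T S \<phi> ` topspace T \<subseteq> topspace T'"
    unfolding source.topspace_arrows target.topspace_arrows
    using bumps_at_induced_map(2) by blast
  fix U assume U: "openin T' U"
  show "openin T {g \<in> topspace T. induced_map T S \<phi> g \<in> U}"
  proof (subst openin_subopen, intro ballI)
    fix g assume "g \<in> {g \<in> topspace T. induced_map T S \<phi> g \<in> U}"
    then have g: "g \<in> arrows G" "induced_map T S \<phi> g \<in> U" by (auto simp: source.topspace_arrows)
    from U g(2) obtain b where b: "b \<in> bumps_at T' S' (induced_map T S \<phi> g)" "dom b \<subseteq> U"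
      by (rule target.bump_in_open)
    from b(1) obtain a where a: "a \<in> bumps_at T S g" "b = \<phi> a"
      unfolding bumps_at_induced_map(1)[OF g(1)] by blast
    let ?V = "T interior_of (values_in invertibles a)"
    have "induced_map T S \<phi> k \<in> U" if k: "k \<in> ?V" for k
    proof -
      have "k \<in> arrows G"
        using k interior_of_subset_topspace[of T "values_in invertibles a"]
        unfolding source.topspace_arrows by blast
      moreover have "a \<in> bumps_at T S k"
        using k source.bumps_at_in[OF a(1)] by (simp add: bumps_at_def)
      ultimately have "b \<in> bumps_at T' S' (induced_map T S \<phi> k)"
        using bumps_at_induced_map(1)[of k] a(2) by blast
      then show ?thesis using b(2) target.bumps_at_dom[of b] by blast
    qed
    moreover have "?V \<subseteq> topspace T" by (rule interior_of_subset_topspace)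
    ultimately have "?V \<subseteq> {g \<in> topspace T. induced_map T S \<phi> g \<in> U}" by blast
    moreover have "g \<in> ?V" using a(1) by (simp add: bumps_at_def)
    moreover have "openin T ?V" by (rule openin_interior_of)
    ultimately show "\<exists>V. openin T V \<and> g \<in> V \<and>
        V \<subseteq> {g \<in> topspace T. induced_map T S \<phi> g \<in> U}" by blast
  qed
qed

text \<open>For all bumps \<open>a\<close> at \<open>g\<close> and \<open>b\<close> at \<open>h\<close>, the image \<open>m\<close> of \<open>gh\<close> factorises through
  \<open>dom (\<phi> a)\<close> and \<open>dom (\<phi> b)\<close>. Within a bisection the range of the left factor determines it,
  and this range is that of \<open>m\<close>; so passing to smaller bumps does not change the factors, and they lie
  in all domains that define the images of \<open>g\<close> and \<open>h\<close>.\<close>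

lemma induced_map_mult:
  assumes gh: "composable G g h"
  shows "composable G' (induced_map T S \<phi> g) (induced_map T S \<phi> h) \<and>
    induced_map T S \<phi> (gmult G g h) = gmult G' (induced_map T S \<phi> g) (induced_map T S \<phi> h)"
proof -
  have arr: "g \<in> arrows G" "h \<in> arrows G" "gmult G g h \<in> arrows G"
    using gh source.mult_closed by (auto simp: composable_def)
  define m where "m = induced_map T S \<phi> (gmult G g h)"
  have fact: "\<exists>k l. k \<in> dom (\<phi> a) \<and> l \<in> dom (\<phi> b) \<and> composable G' k l \<and> m = gmult G' k l"
    if ab: "a \<in> bumps_at T S g" "b \<in> bumps_at T S h" for a b
  proof -
    have "fun_mult G a b \<in> bumps_at T S (gmult G g h)"
      using ab gh by (rule source.bumps_at_mult)
    then have "\<phi> (fun_mult G a b) \<in> bumps_at T' S' m"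
      unfolding m_def bumps_at_induced_map(1)[OF arr(3)] by (rule imageI)
    then have "fun_mult G' (\<phi> a) (\<phi> b) \<in> bumps_at T' S' m"
      using image_mult[OF ab[THEN source.bumps_at_in]] by simp
    then have "m \<in> dom (fun_mult G' (\<phi> a) (\<phi> b))" by (rule target.bumps_at_dom)
    then show ?thesis by (rule target.dom_fun_multE) blast
  qed
  obtain a0 where a0: "a0 \<in> bumps_at T S g" using source.bumps_at_nonempty[OF arr(1)] .
  obtain b0 where b0: "b0 \<in> bumps_at T S h" using source.bumps_at_nonempty[OF arr(2)] .
  obtain k l where kl: "k \<in> dom (\<phi> a0)" "composable G' k l" "m = gmult G' k l"
    using fact[OF a0 b0] by blast
  have in_doms: "k \<in> dom (\<phi> a) \<and> l \<in> dom (\<phi> b)"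
    if ab: "a \<in> bumps_at T S g" "b \<in> bumps_at T S h" for a b
  proof -
    obtain c where c: "c \<in> bumps_at T S g" "dominated G S c a" "dominated G S c a0"
      using source.bumps_at_directed[OF arr(1) ab(1) a0] .
    obtain d where d: "d \<in> bumps_at T S h" "dominated G S d b"
      using source.bumps_at_directed[OF arr(2) ab(2) ab(2)] .
    have mono: "dom (\<phi> p) \<subseteq> dom (\<phi> q)" if "p \<in> S" "q \<in> S" "dominated G S p q" for p q
      using target.dominated_dom_subset[OF image_in image_in image_dominated] that by simp
    have sub: "dom (\<phi> c) \<subseteq> dom (\<phi> a)" "dom (\<phi> c) \<subseteq> dom (\<phi> a0)" "dom (\<phi> d) \<subseteq> dom (\<phi> b)"
      using mono c d a0 ab source.bumps_at_in by auto
    obtain k' l' where k': "k' \<in> dom (\<phi> c)" "l' \<in> dom (\<phi> d)" "composable G' k' l'"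
      "m = gmult G' k' l'" using fact[OF c(1) d(1)] by blast
    have "bisection G' (dom (\<phi> a0))"
      using target.dom_bisection[OF image_in[OF source.bumps_at_in[OF a0]]] .
    moreover have "k' \<in> dom (\<phi> a0)" using k'(1) sub(2) by blast
    moreover have "gmult G' k l = gmult G' k' l'" using kl(3) k'(4) by simp
    ultimately have "k = k' \<and> l = l'"
      using target.bisection_factors_unique[OF _ kl(1) _ kl(2) k'(3)] by blast
    then show ?thesis using k' sub by blast
  qed
  have "k = induced_map T S \<phi> g"
    using in_doms[OF _ b0] induced_map_singleton[OF arr(1)] by blast
  moreover have "l = induced_map T S \<phi> h"
    using in_doms[OF a0] induced_map_singleton[OF arr(2)] by blast
  ultimately show ?thesis using kl m_def by simp
qed

lemma homeomorphic_induced_map: "homeomorphic_map T T' (induced_map T S \<phi>)"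
proof -
  interpret inv: diagonal_iso G' T' S' G T S "inv_into S \<phi>" by (rule inverse_diagonal_iso)
  have "homeomorphic_maps T T' (induced_map T S \<phi>) (induced_map T' S' (inv_into S \<phi>))"
    unfolding homeomorphic_maps_def source.topspace_arrows target.topspace_arrows
    using continuous_induced_map inv.continuous_induced_map induced_map_inverse
      induced_map_inverse' by blast
  then show ?thesis by (rule homeomorphic_maps_imp_map)
qed

lemma groupoid_iso_induced_map: "groupoid_iso G G' (induced_map T S \<phi>)"
proof -
  interpret inv: diagonal_iso G' T' S' G T S "inv_into S \<phi>" by (rule inverse_diagonal_iso)
  have "bij_betw (induced_map T S \<phi>) (arrows G) (arrows G')"
    by (rule bij_betw_byWitness[of _ "induced_map T' S' (inv_into S \<phi>)"])
      (use bumps_at_induced_map(2) inv.bumps_at_induced_map(2) induced_map_inverse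
        induced_map_inverse' in auto)
  moreover have "composable G g h"
    if "g \<in> arrows G" "h \<in> arrows G" "composable G' (induced_map T S \<phi> g) (induced_map T S \<phi> h)"
    for g h
    using inv.induced_map_mult[OF that(3)] induced_map_inverse that(1,2) by simp
  ultimately show ?thesis unfolding groupoid_iso_def using induced_map_mult by blast
qed

end

theorem corollary5p4:
  fixes G :: "'g groupoid_data" and G' :: "'h groupoid_data"
    and T :: "'g topology" and T' :: "'h topology"
    and S :: "('g \<rightharpoonup> 'y::monoid_mult) set" and S' :: "('h \<rightharpoonup> 'z::monoid_mult) set"
    and \<phi> :: "('g \<rightharpoonup> 'y) \<Rightarrow> ('h \<rightharpoonup> 'z)"
  assumes "groupoid G" and "groupoid G'"
    and "topspace T = arrows G" and "topspace T' = arrows G'"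
    and "Hausdorff_space (subtopology T (gunits G))"
    and "Hausdorff_space (subtopology T' (gunits G'))"
    and "one_cancellative TYPE('y)" and "one_cancellative TYPE('z)"
    and "fun_semigroup G T S" and "bumpy G T S"
    and "fun_semigroup G' T' S'" and "bumpy G' T' S'"
    and "fun_semigroup_iso G S G' S' \<phi>"
    and "\<phi> ` diagonal G S = diagonal G' S'"
  shows "(\<forall>g\<in>arrows G. {induced_map T S \<phi> g} = (\<Inter>a\<in>bumps_at T S g. dom (\<phi> a))) \<and>
    homeomorphic_map T T' (induced_map T S \<phi>) \<and>
    groupoid_iso G G' (induced_map T S \<phi>)"
proof -
  interpret diagonal_iso G T S G' T' S' \<phi>
    using assms by (simp add: diagonal_iso_def diagonal_iso_axioms_def bumpy_semigroup_def
        bumpy_semigroup_axioms_def)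
  show ?thesis
    using induced_map_singleton homeomorphic_induced_map groupoid_iso_induced_map by blast
qed

end
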